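(* Let $d\ge 2$ and suppose $\ln\frac1\epsilon\gg\ln d$. The algorithms $(\mathcal{A}_p)_{1\le p\le d}$ described in the context effectively provide a trade-off for $p\leq\mathcal{O}\left(\min\left(\frac{\ln\frac{1}{\epsilon}}{\ln d},d\right)\right)$. Precisely, there is an integer $1\le p_{\max}\le d$ with $p_{\max}=\mathcal{O}\left(\min\left(\frac{\ln\frac{1}{\epsilon}}{\ln d},d\right)\right)$ such that the algorithms $\mathcal{A}_p$, $1\leq p\leq p_{\max}$, provide a trade-off between 1. (for $p=1$) using $\mathcal{O}\left(d^2\ln\frac1\epsilon\right)$ bits of memory with optimal $\mathcal{O}\left(d\ln\frac1\epsilon\right)$ oracle-complexity, and 2. (for $p=p_{\max}$) using $\mathcal{O}\left(\max\left(d^2\ln d,\;d\ln\frac1\epsilon\right)\right)$ bits of memory with $\mathcal{O}\left(\min\left(\frac{1}{\epsilon^2},\;\left(C\ln\frac1\epsilon\right)^d\right)\right)$ oracle-complexity.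
   Context: Feasibility problem. Let $\mathcal{C}_d=[-1,1]^d$. An unknown convex set $Q\subset\mathcal{C}_d$ is accessed through a consistent separation oracle which at a query $x\in \mathcal{C}_d$ returns $\mathsf{Success}$ if $x\in Q$, and otherwise a vector $g\in\mathbb{R}^d$ with $\|g\|_2=1$ and $g^\top x<g^\top x'$ for all $x'\in Q$. An algorithm solves the problem with accuracy $\epsilon$ if it finds a point of $Q$ for every such problem in which $Q$ contains a Euclidean ball $B_d(x^\star,\epsilon)$ with $x^\star\in\mathcal{C}_d$. Oracle-complexity is the number of calls to the separation oracle; memory is counted in bits. The family $(\mathcal{A}_p)$. There is a universal constant $C\ge1$ and, for each $1\le p\le d$ and $\epsilon\le 1/\sqrt d$, a deterministic algorithm $\mathcal{A}_p$ solving the feasibility problem with accuracy $\epsilon$ using $\mathcal{O}\left(\frac{d^2}{p}\ln\frac1\epsilon\right)$ bits of memory and $\mathcal{O}\left(\left(C\frac dp\ln\frac1\epsilon\right)^p\right)$ calls to the separation oracle, with universal constants hidden in $\mathcal{O}(\cdot)$. The condition $\ln\frac1\epsilon\gg\ln d$ means $\ln\frac1\epsilon\geq K\ln d$ for a sufficiently large universal constant $K$. *)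

theory Defs
  imports Complex_Main "Jordan_Normal_Form.Matrix"
begin

text \<open>
  The dimension \<open>d\<close> is quantified inside the theorem (the constants do not depend on it), so
  points of $\mathbb{R}^d$ are elements of \<^term>\<open>carrier_vec d :: real vec set\<close>.
\<close>

definition vec_norm2 :: "real vec \<Rightarrow> real" where
  "vec_norm2 v = sqrt (v \<bullet> v)"

definition cube :: "nat \<Rightarrow> real vec set" where
  "cube d = {x \<in> carrier_vec d. \<forall>i<d. -1 \<le> x $ i \<and> x $ i \<le> 1}"

definition vec_ball :: "nat \<Rightarrow> real vec \<Rightarrow> real \<Rightarrow> real vec set" where
  "vec_ball d x r = {y \<in> carrier_vec d. vec_norm2 (y - x) \<le> r}"

definition convex_vecs :: "real vec set \<Rightarrow> bool" where
  "convex_vecs Q \<longleftrightarrow>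
     (\<forall>x\<in>Q. \<forall>y\<in>Q. \<forall>u\<ge>0. \<forall>v\<ge>0. u + v = 1 \<longrightarrow> u \<cdot>\<^sub>v x + v \<cdot>\<^sub>v y \<in> Q)"

definition feasibility_instance :: "nat \<Rightarrow> real \<Rightarrow> real vec set \<Rightarrow> bool" where
  "feasibility_instance d \<epsilon> Q \<longleftrightarrow>
     Q \<subseteq> cube d \<and> convex_vecs Q \<and> (\<exists>x\<in>cube d. vec_ball d x \<epsilon> \<subseteq> Q)"

datatype response = Success | Separator "real vec"

definition separation_oracle ::
    "nat \<Rightarrow> real vec set \<Rightarrow> (real vec \<Rightarrow> response) \<Rightarrow> bool" where
  "separation_oracle d Q orc \<longleftrightarrow>
     (\<forall>x\<in>cube d. if x \<in> Q then orc x = Success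
        else \<exists>g\<in>carrier_vec d. orc x = Separator g \<and> vec_norm2 g = 1 \<and>
               (\<forall>x'\<in>Q. g \<bullet> x < g \<bullet> x'))"

text \<open>
  A deterministic algorithm with state space \<open>'s\<close>: between two oracle calls it remembers only
  its state. The next query is a function of the state, and the next state is a function of the
  state, the query and the response.
\<close>

record 's algorithm =
  init_state :: 's
  query :: "'s \<Rightarrow> real vec"
  update :: "'s \<Rightarrow> real vec \<Rightarrow> response \<Rightarrow> 's"

definition algorithm_on :: "nat \<Rightarrow> 's set \<Rightarrow> 's algorithm \<Rightarrow> bool" where
  "algorithm_on d S alg \<longleftrightarrow>
     init_state alg \<in> S \<and>
     (\<forall>s\<in>S. query alg s \<in> cube d) \<and>
     (\<forall>s\<in>S. \<forall>x\<in>cube d. \<forall>r\<in>insert Success (Separator ` carrier_vec d). update alg s x r \<in> S)"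

definition bit_algorithm :: "nat \<Rightarrow> nat \<Rightarrow> bool list algorithm \<Rightarrow> bool" where
  "bit_algorithm d M alg \<longleftrightarrow> algorithm_on d {s. length s = M} alg"

text \<open>
  No memory restriction: the state can hold the complete history of queries and responses.
  Any deterministic algorithm makes the same queries as one with this state space.
\<close>

type_synonym history = "(real vec \<times> response) list"

definition unrestricted_algorithm :: "nat \<Rightarrow> history algorithm \<Rightarrow> bool" where
  "unrestricted_algorithm d alg \<longleftrightarrow> algorithm_on d UNIV alg"

fun state_at :: "'s algorithm \<Rightarrow> (real vec \<Rightarrow> response) \<Rightarrow> nat \<Rightarrow> 's" where
  "state_at alg orc 0 = init_state alg"
| "state_at alg orc (Suc t) =
     (let s = state_at alg orc t; x = query alg s in update alg s x (orc x))"

text \<open>A point of \<open>Q\<close> is found when the oracle answers \<^term>\<open>Success\<close>; that call is counted.\<close>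

definition solves_in :: "nat \<Rightarrow> real \<Rightarrow> nat \<Rightarrow> 's algorithm \<Rightarrow> bool" where
  "solves_in d \<epsilon> N alg \<longleftrightarrow>
     (\<forall>Q orc. feasibility_instance d \<epsilon> Q \<and> separation_oracle d Q orc \<longrightarrow>
        (\<exists>t<N. orc (query alg (state_at alg orc t)) = Success))"

definition solves_with ::
    "nat \<Rightarrow> real \<Rightarrow> bool list algorithm \<Rightarrow> real \<Rightarrow> real \<Rightarrow> bool" where
  "solves_with d \<epsilon> alg bits calls \<longleftrightarrow>
     (\<exists>M N. real M \<le> bits \<and> real N \<le> calls \<and> bit_algorithm d M alg \<and> solves_in d \<epsilon> N alg)"

text \<open>
  The bounds for the algorithm with parameter \<open>p\<close>, without the constants hidden in
  $\mathcal{O}(\cdot)$; \<open>C\<close> lies inside the \<open>p\<close>-th power and is therefore explicit.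
\<close>

definition memory_rate :: "nat \<Rightarrow> nat \<Rightarrow> real \<Rightarrow> real" where
  "memory_rate d p \<epsilon> = real d ^ 2 / real p * ln (1 / \<epsilon>)"

definition oracle_rate :: "real \<Rightarrow> nat \<Rightarrow> nat \<Rightarrow> real \<Rightarrow> real" where
  "oracle_rate C d p \<epsilon> = (C * (real d / real p) * ln (1 / \<epsilon>)) ^ p"

text \<open>
  The constants are uniform in \<open>d\<close>, \<open>p\<close> and \<open>\<epsilon>\<close>. The dimension \<open>d = 1\<close> is left out because the
  call bound tends to 0 there as \<open>\<epsilon>\<close> tends to 1, so that no algorithm could meet it.
\<close>

definition feasibility_family ::
    "real \<Rightarrow> (nat \<Rightarrow> nat \<Rightarrow> real \<Rightarrow> bool list algorithm) \<Rightarrow> bool" where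
  "feasibility_family C A \<longleftrightarrow>
     (\<exists>a>0. \<exists>b>0. \<forall>d\<ge>2. \<forall>p\<in>{1..d}. \<forall>\<epsilon>. 0 < \<epsilon> \<and> \<epsilon> \<le> 1 / sqrt (real d) \<longrightarrow>
        solves_with d \<epsilon> (A d p \<epsilon>) (a * memory_rate d p \<epsilon>) (b * oracle_rate C d p \<epsilon>))"

end

theory Submission
  imports Defs
begin

text \<open>
  Write \<open>L = ln (1 / \<epsilon>)\<close>. Two independent arguments carry the theorem.

  The upper bounds are calculus for the rate $(C d L / p)^p = \exp (p \ln (C d L / p))$. The map
  $p \mapsto p \ln (y / p)$ increases as long as $e p \le y$ (\<open>rate_exponent_less\<close>), and $y = C d L$
  exceeds $e d$ once $L \ge 3$. Hence the number of calls grows with \<open>p\<close> on the whole range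
  \<open>1 \<le> p \<le> d\<close>, while the memory visibly decreases, and the rate never exceeds its value
  $(C L)^d$ at \<open>p = d\<close>. The remaining requirement is that the rate stay below
  $1 / \epsilon^2 = e^{2 L}$. At the real parameter $x = L / (4 C \ln d)$ the exponent equals
  $x \ln (4 C^2 d \ln d)$. That logarithm is at most $8 C \ln d$, so that the exponent is at most
  $2 L$ at \<open>x\<close> and, by monotonicity, at every $p \le x$ (\<open>rate_exponent_le\<close>). Therefore
  $p_{\max} = \min (d, \lfloor x \rfloor)$: if it is \<open>d\<close>, the memory is \<open>d L\<close>; otherwise it is at
  least $x / 2$ and the memory is $O(d^2 \ln d)$.

  The optimality of $d L$ calls for \<open>p = 1\<close> is an adversary argument. The adversary keeps a box that
  is still consistent with all its answers. A new query is answered by a cut parallel to a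
  coordinate hyperplane through the middle of the box, and the half on the other side of the query
  is kept. As long as fewer than \<open>d * m\<close> queries were answered, some coordinate was halved fewer
  than \<open>m\<close> times, so that \<open>d * m\<close> queries leave a box with all sides at least $2 / 2^m$
  (\<open>resisting_transcript\<close>). If $\epsilon < 1 / 2^m$, a cube around its centre is a feasible set that
  no query has hit (\<open>calls_lower_bound\<close>). The choice $m = \lfloor L \rfloor$ gives the bound.
\<close>

section \<open>Growth of the call bound in the parameter\<close>

text \<open>
  Since \<open>ln (y / p) = ln (y / q) + ln (q / p)\<close>, the difference of the two sides is
  \<open>(q - p) * ln (y / q) - p * ln (q / p)\<close>. Here \<open>ln (y / q) \<ge> 1\<close>, and \<open>p * ln (q / p) < q - p\<close> because
  the logarithm lies strictly below its tangent at 1.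
\<close>

lemma rate_exponent_less:
  fixes p q y :: real
  assumes "0 < p" "p < q" "exp 1 * q \<le> y"
  shows "p * ln (y / p) < q * ln (y / q)"
proof -
  have "0 < q"
    using assms by simp
  then have "0 < exp 1 * q"
    by simp
  then have "0 < y"
    using assms(3) by linarith
  have split: "ln (y / p) = ln (y / q) + ln (q / p)"
    using \<open>0 < q\<close> \<open>0 < y\<close> assms(1) by (simp add: ln_div)
  have "exp 1 \<le> y / q"
    using assms(3) \<open>0 < q\<close> by (simp add: field_simps)
  then have "1 \<le> ln (y / q)"
    using \<open>0 < q\<close> \<open>0 < y\<close> by (simp add: ln_ge_iff)
  then have main: "q - p \<le> (q - p) * ln (y / q)"
    using assms(2) by simp
  have "ln (q / p) < q / p - 1"
    using ln_add_one_self_less_self[of "q / p - 1"] assms(1,2) by (simp del: ln_div)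
  then have "p * ln (q / p) < p * (q / p - 1)"
    using assms(1) by (rule mult_strict_left_mono)
  also have "\<dots> = q - p"
    using assms(1) by (simp add: field_simps)
  finally have "p * ln (q / p) < (q - p) * ln (y / q)"
    using main by linarith
  then show ?thesis
    unfolding split by (simp add: algebra_simps)
qed

lemma oracle_rate_eq_exp:
  assumes "0 < C" "0 < d" "0 < p" "0 < ln (1 / \<epsilon>)"
  shows "oracle_rate C d p \<epsilon> = exp (real p * ln (C * real d * ln (1 / \<epsilon>) / real p))"
proof -
  have "0 < C * real d * ln (1 / \<epsilon>) / real p"
    using assms by simp
  then show ?thesis
    by (simp add: oracle_rate_def exp_of_nat_mult del: ln_div ln_mult)
qed

lemma oracle_rate_less:
  assumes "1 \<le> C" "1 \<le> p" "p < q" "q \<le> d" "3 \<le> ln (1 / \<epsilon>)"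
  shows "oracle_rate C d p \<epsilon> < oracle_rate C d q \<epsilon>"
proof -
  let ?L = "ln (1 / \<epsilon>)"
  have "exp 1 * real q \<le> 3 * real d"
    using exp_le assms(4) by (intro mult_mono) auto
  also have "\<dots> \<le> C * real d * ?L"
    using mult_left_mono[OF mult_mono[OF assms(1,5)], of "real d"] assms(1)
    by (simp add: mult.commute mult.left_commute del: ln_div)
  finally have "exp 1 * real q \<le> C * real d * ?L" .
  then have "real p * ln (C * real d * ?L / real p) < real q * ln (C * real d * ?L / real q)"
    using assms by (intro rate_exponent_less) auto
  then show ?thesis
    using assms by (simp add: oracle_rate_eq_exp del: ln_div ln_mult)
qed

lemma oracle_rate_le_full:
  assumes "1 \<le> C" "1 \<le> p" "p \<le> d" "3 \<le> ln (1 / \<epsilon>)"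
  shows "oracle_rate C d p \<epsilon> \<le> (C * ln (1 / \<epsilon>)) ^ d"
proof -
  have "oracle_rate C d p \<epsilon> \<le> oracle_rate C d d \<epsilon>"
    using oracle_rate_less[OF assms(1,2) _ order_refl assms(4)] assms(3)
    by (cases "p = d") (auto simp: less_imp_le)
  also have "\<dots> = (C * ln (1 / \<epsilon>)) ^ d"
    using assms by (simp add: oracle_rate_def del: ln_div)
  finally show ?thesis .
qed

lemma memory_rate_less:
  assumes "1 \<le> p" "p < q" "0 < d" "0 < ln (1 / \<epsilon>)"
  shows "memory_rate d q \<epsilon> < memory_rate d p \<epsilon>"
proof -
  have "real d ^ 2 / real q < real d ^ 2 / real p"
    using assms by (intro divide_strict_left_mono) auto
  then show ?thesis
    unfolding memory_rate_def using assms(4) by (rule mult_strict_right_mono)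
qed

section \<open>The largest useful parameter\<close>

lemma nat_floor_bounds:
  fixes x :: real
  assumes "1 \<le> x"
  shows "1 \<le> nat \<lfloor>x\<rfloor>" "real (nat \<lfloor>x\<rfloor>) \<le> x" "x - 1 < real (nat \<lfloor>x\<rfloor>)"
proof -
  have "1 \<le> \<lfloor>x\<rfloor>"
    using assms by simp
  then show "1 \<le> nat \<lfloor>x\<rfloor>" "real (nat \<lfloor>x\<rfloor>) \<le> x" "x - 1 < real (nat \<lfloor>x\<rfloor>)"
    by simp_all linarith+
qed

lemma ln_ge_half:
  assumes "2 \<le> d"
  shows "1 / 2 \<le> ln (real d)"
proof -
  have "exp 1 \<le> (2 :: real) ^ 2"
    using exp_le by simp
  then have "1 \<le> ln ((2 :: real) ^ 2)"
    by (subst ln_ge_iff) auto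
  then have "1 / 2 \<le> ln (2 :: real)"
    using ln_realpow[of 2 2] by simp
  also have "\<dots> \<le> ln (real d)"
    using assms by simp
  finally show ?thesis .
qed

text \<open>
  Substituting $x = L / (4 C \ln d)$ for \<open>p\<close> turns the argument of the logarithm into
  $4 C^2 d \ln d$, which no longer depends on \<open>L\<close>. The four factors contribute at most
  $2 \ln d$, $4 (C - 1) \ln d$, $\ln d$ and $\ln d$ to its logarithm, and the denominator of \<open>x\<close>
  absorbs their sum.
\<close>

lemma rate_exponent_le:
  fixes C L p :: real
  assumes "1 \<le> C" "2 \<le> d" "0 < p" "p \<le> L / (4 * C * ln (real d))"
  shows "p * ln (C * real d * L / p) \<le> 2 * L"
proof -
  define D where "D = ln (real d)"
  define x where "x = L / (4 * C * D)"
  have D: "1 / 2 \<le> D"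
    using ln_ge_half[OF assms(2)] by (simp add: D_def)
  have px: "p \<le> x"
    using assms(4) by (simp add: x_def D_def)
  have "0 < x"
    using px assms(3) by simp
  have "C \<noteq> 0" "D \<noteq> 0"
    using assms(1) D by auto
  then have L: "L = x * (4 * C * D)"
    by (simp add: x_def)
  have arg: "C * real d * L / x = 4 * C ^ 2 * real d * D"
    using \<open>0 < x\<close> by (simp add: L power2_eq_square)
  have C2: "1 \<le> C ^ 2"
    using assms(1) by simp
  have "1 * (2 * (1 / 2)) \<le> C ^ 2 * (real d * D)"
    using C2 assms(2) D by (intro mult_mono) auto
  then have "exp 1 \<le> C * real d * L / x"
    using exp_le unfolding arg by (simp add: mult.assoc)
  then have large: "exp 1 * x \<le> C * real d * L"
    using \<open>0 < x\<close> by (simp add: field_simps)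
  have "p * ln (C * real d * L / p) \<le> x * ln (C * real d * L / x)"
    using rate_exponent_less[OF assms(3) _ large] px by (cases "p = x") auto
  also have "\<dots> \<le> x * (8 * C * D)"
  proof (rule mult_left_mono)
    have "ln (4 * C ^ 2 * real d * D) = ln 4 + 2 * ln C + D + ln D"
      using assms(1,2) D by (simp add: ln_mult ln_realpow D_def)
    moreover have "ln (4 :: real) \<le> 2 * D"
    proof -
      have "ln (4 :: real) = 2 * ln 2"
        using ln_realpow[of 2 2] by simp
      moreover have "ln 2 \<le> D"
        using assms(2) by (simp add: D_def)
      ultimately show ?thesis
        by simp
    qed
    moreover have "2 * ln C \<le> 4 * (C - 1) * D"
    proof -
      have "2 * ln C \<le> 2 * (C - 1)"
        using ln_le_minus_one[of C] assms(1) by simp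
      also have "\<dots> = 4 * (C - 1) * (1 / 2)"
        by simp
      also have "\<dots> \<le> 4 * (C - 1) * D"
        using D assms(1) by (intro mult_left_mono) auto
      finally show ?thesis .
    qed
    moreover have "ln D \<le> D"
      using ln_le_minus_one[of D] D by simp
    moreover have "D \<le> C * D"
      using assms(1) D by simp
    moreover have "4 * (C - 1) * D = 4 * (C * D) - 4 * D" "8 * C * D = 8 * (C * D)"
      by (simp_all add: algebra_simps)
    ultimately show "ln (C * real d * L / x) \<le> 8 * C * D"
      unfolding arg using D by linarith
  qed (use \<open>0 < x\<close> in simp)
  also have "\<dots> = 2 * L"
    by (simp add: L)
  finally show ?thesis .
qed

lemma oracle_rate_le_inverse_square:
  assumes "1 \<le> C" "2 \<le> d" "1 \<le> p" "real p \<le> ln (1 / \<epsilon>) / (4 * C * ln (real d))"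
    "0 < \<epsilon>" "0 < ln (1 / \<epsilon>)"
  shows "oracle_rate C d p \<epsilon> \<le> 1 / \<epsilon> ^ 2"
proof -
  have "oracle_rate C d p \<epsilon> = exp (real p * ln (C * real d * ln (1 / \<epsilon>) / real p))"
    using assms by (intro oracle_rate_eq_exp) auto
  also have "\<dots> \<le> exp (2 * ln (1 / \<epsilon>))"
    using rate_exponent_le[OF assms(1,2) _ assms(4)] assms(3) by simp
  also have "\<dots> = 1 / \<epsilon> ^ 2"
    using assms(5) exp_of_nat_mult[of 2 "ln (1 / \<epsilon>)"]
    by (simp add: power_one_over exp_minus inverse_eq_divide ln_div)
  finally show ?thesis .
qed

text \<open>
  Both cases of the minimum that defines the largest parameter appear in the maximum on the right:
  the value \<open>d\<close> gives \<open>d * L\<close>, and rounding down a real number that is at least 1 loses at most a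
  factor 2, which gives the other term.
\<close>

lemma memory_rate_at_max:
  fixes C \<epsilon> :: real and d :: nat
  defines "x \<equiv> ln (1 / \<epsilon>) / (4 * C * ln (real d))"
  assumes "1 \<le> C" "2 \<le> d" "1 \<le> x"
  shows "memory_rate d (min d (nat \<lfloor>x\<rfloor>)) \<epsilon>
    \<le> 8 * C * max (real d ^ 2 * ln (real d)) (real d * ln (1 / \<epsilon>))"
    (is "_ \<le> 8 * C * ?M")
proof -
  define L where "L = ln (1 / \<epsilon>)"
  have D: "0 < ln (real d)"
    using ln_ge_half[OF assms(3)] by simp
  have den: "0 < 4 * C * ln (real d)"
    using D assms(2) by simp
  have "C \<noteq> 0" "ln (real d) \<noteq> 0"
    using assms(2) D by auto
  then have L: "L = x * (4 * C * ln (real d))"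
    by (simp add: x_def L_def del: ln_div)
  have "0 < L"
    unfolding L using den assms(4) by simp
  show ?thesis
  proof (cases "d \<le> nat \<lfloor>x\<rfloor>")
    case True
    then have "memory_rate d (min d (nat \<lfloor>x\<rfloor>)) \<epsilon> = 1 * (real d * L)"
      using assms(3) by (simp add: memory_rate_def min_def L_def power2_eq_square del: ln_div)
    also have "\<dots> \<le> 8 * C * ?M"
      unfolding L_def[symmetric] using assms(2) \<open>0 < L\<close> by (intro mult_mono) auto
    finally show ?thesis .
  next
    case False
    define p where "p = nat \<lfloor>x\<rfloor>"
    have "1 \<le> real p" "x - 1 < real p"
      using nat_floor_bounds[OF assms(4)] by (simp_all add: p_def)
    then have half: "x \<le> 2 * real p"
      by linarith
    have "memory_rate d (min d (nat \<lfloor>x\<rfloor>)) \<epsilon> = real d ^ 2 / real p * L"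
      using False by (simp add: memory_rate_def min_def L_def p_def del: ln_div)
    also have "\<dots> = x / real p * (4 * C * (real d ^ 2 * ln (real d)))"
      by (simp add: L)
    also have "\<dots> \<le> 2 * (4 * C * (real d ^ 2 * ln (real d)))"
      using half \<open>1 \<le> real p\<close> D assms(2)
      by (intro mult_right_mono) (auto simp: field_simps)
    also have "\<dots> = 8 * C * (real d ^ 2 * ln (real d))"
      by simp
    also have "\<dots> \<le> 8 * C * ?M"
      using assms(2) by (intro mult_left_mono) auto
    finally show ?thesis .
  qed
qed

section \<open>A resisting oracle\<close>

definition separates :: "nat \<Rightarrow> real vec set \<Rightarrow> real vec \<Rightarrow> real vec \<Rightarrow> bool" where
  "separates d Q x g \<longleftrightarrow> g \<in> carrier_vec d \<and> vec_norm2 g = 1 \<and> (\<forall>x'\<in>Q. g \<bullet> x < g \<bullet> x')"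

definition open_box :: "nat \<Rightarrow> (nat \<Rightarrow> real) \<Rightarrow> (nat \<Rightarrow> real) \<Rightarrow> real vec set" where
  "open_box d l u = {x \<in> carrier_vec d. \<forall>i<d. l i < x $ i \<and> x $ i < u i}"

text \<open>
  Balls of the maximum norm serve as feasible sets: a violated coordinate constraint is itself a
  separator, and they contain the Euclidean balls of the same radius.
\<close>

definition max_ball :: "nat \<Rightarrow> real vec \<Rightarrow> real \<Rightarrow> real vec set" where
  "max_ball d c r = {x \<in> carrier_vec d. \<forall>i<d. \<bar>x $ i - c $ i\<bar> \<le> r}"

lemma separates_mono: "separates d Q x g \<Longrightarrow> Q' \<subseteq> Q \<Longrightarrow> separates d Q' x g"
  by (auto simp: separates_def)

lemma open_box_mono:
  "(\<And>i. i < d \<Longrightarrow> l i \<le> l' i \<and> u' i \<le> u i) \<Longrightarrow> open_box d l' u' \<subseteq> open_box d l u"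
  by (force simp: open_box_def)

lemma separates_by_coordinate:
  assumes "x \<in> carrier_vec d" "Q \<subseteq> carrier_vec d" "i < d" "s = 1 \<or> s = - 1"
    and "\<And>x'. x' \<in> Q \<Longrightarrow> s * x $ i < s * x' $ i"
  shows "separates d Q x (s \<cdot>\<^sub>v unit_vec d i)"
proof -
  have inner: "(s \<cdot>\<^sub>v unit_vec d i) \<bullet> v = s * v $ i" if "v \<in> carrier_vec d" for v :: "real vec"
    using that assms(3) by simp
  have "vec_norm2 (s \<cdot>\<^sub>v unit_vec d i) = 1"
    using assms(3,4) unfolding vec_norm2_def by (subst inner) auto
  then show ?thesis
    using assms inner by (auto simp: separates_def subset_iff)
qed

lemma max_ball_separator:
  assumes "x \<in> carrier_vec d" "x \<notin> max_ball d c r"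
  shows "\<exists>g. separates d (max_ball d c r) x g"
proof -
  obtain i where i: "i < d" "r < \<bar>x $ i - c $ i\<bar>"
    using assms by (force simp: max_ball_def)
  define s :: real where "s = (if x $ i < c $ i then 1 else - 1)"
  have "separates d (max_ball d c r) x (s \<cdot>\<^sub>v unit_vec d i)"
  proof (rule separates_by_coordinate)
    fix x' assume "x' \<in> max_ball d c r"
    then have "\<bar>x' $ i - c $ i\<bar> \<le> r"
      using i(1) by (simp add: max_ball_def)
    then show "s * x $ i < s * x' $ i"
      using i(2) unfolding s_def by (simp only: split: if_split) linarith
  qed (use assms i in \<open>auto simp: s_def max_ball_def\<close>)
  then show ?thesis ..
qed

lemma abs_index_le_vec_norm2:
  assumes "v \<in> carrier_vec d" "i < d"
  shows "\<bar>v $ i\<bar> \<le> vec_norm2 v"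
proof -
  have "(v $ i)\<^sup>2 \<le> (\<Sum>j = 0..<d. (v $ j)\<^sup>2)"
    using assms(2) by (intro member_le_sum) auto
  then have "sqrt ((v $ i)\<^sup>2) \<le> vec_norm2 v"
    using assms(1) unfolding vec_norm2_def
    by (intro real_sqrt_le_mono) (simp add: scalar_prod_def power2_eq_square)
  then show ?thesis
    by simp
qed

lemma vec_ball_subset_max_ball:
  assumes "c \<in> carrier_vec d"
  shows "vec_ball d c r \<subseteq> max_ball d c r"
proof
  fix y assume y: "y \<in> vec_ball d c r"
  then have "y \<in> carrier_vec d" "vec_norm2 (y - c) \<le> r"
    by (auto simp: vec_ball_def)
  moreover have "\<bar>y $ i - c $ i\<bar> \<le> vec_norm2 (y - c)" if "i < d" for i
    using abs_index_le_vec_norm2[of "y - c" d i] that assms \<open>y \<in> carrier_vec d\<close> by simp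
  ultimately show "y \<in> max_ball d c r"
    by (force simp: max_ball_def)
qed

lemma convex_max_ball:
  assumes "c \<in> carrier_vec d"
  shows "convex_vecs (max_ball d c r)"
  unfolding convex_vecs_def
proof (intro ballI allI impI)
  fix x y and a b :: real
  assume x: "x \<in> max_ball d c r" and y: "y \<in> max_ball d c r"
    and ab: "0 \<le> a" "0 \<le> b" "a + b = 1"
  have carrier: "x \<in> carrier_vec d" "y \<in> carrier_vec d"
    using x y by (auto simp: max_ball_def)
  have "\<bar>a * x $ i + b * y $ i - c $ i\<bar> \<le> r" if "i < d" for i
  proof -
    have "a * x $ i + b * y $ i - c $ i = a * (x $ i - c $ i) + b * (y $ i - c $ i)"
      using arg_cong[OF ab(3), of "\<lambda>z. z * c $ i"] by (simp add: algebra_simps)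
    also have "\<bar>\<dots>\<bar> \<le> a * \<bar>x $ i - c $ i\<bar> + b * \<bar>y $ i - c $ i\<bar>"
      using abs_triangle_ineq[of "a * (x $ i - c $ i)" "b * (y $ i - c $ i)"] ab
      by (simp add: abs_mult)
    also have "\<dots> \<le> r"
      using x y that ab by (intro convex_bound_le) (auto simp: max_ball_def)
    finally show ?thesis .
  qed
  then show "a \<cdot>\<^sub>v x + b \<cdot>\<^sub>v y \<in> max_ball d c r"
    using carrier by (simp add: max_ball_def)
qed

lemma state_at_cong:
  assumes "\<And>s. s < t \<Longrightarrow>
    orc' (query alg (state_at alg orc s)) = orc (query alg (state_at alg orc s))"
  shows "state_at alg orc' t = state_at alg orc t"
  using assms by (induction t) (simp_all add: Let_def)

text \<open>
  The adversary. \<open>X\<close> collects the queries answered so far, the open box is what every answer has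
  left feasible, and \<open>k i\<close> counts the halvings of side \<open>i\<close>. Each step halves at most one side, so
  while \<open>n < d * m\<close> some side still has a halving to spend. An oracle is a function of the query, so
  a repeated query must receive its old answer, which costs nothing. For a new query only the value
  of the oracle at that point changes, and the earlier part of the run stays as it was.
\<close>

lemma resisting_transcript:
  assumes "\<And>s. query alg s \<in> cube d" "n \<le> d * m"
  shows "\<exists>orc X l u k.
    (\<forall>t<n. query alg (state_at alg orc t) \<in> X) \<and>
    (\<forall>x\<in>X. \<exists>g. orc x = Separator g \<and> separates d (open_box d l u) x g) \<and>
    (\<forall>i<d. - 1 \<le> l i \<and> u i \<le> 1 \<and> u i - l i = 2 / 2 ^ k i \<and> k i \<le> m) \<and>
    (\<Sum>i<d. k i) \<le> n"
  using assms(2)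
proof (induction n)
  case 0
  show ?case
    by (rule exI[of _ "\<lambda>_. Success"], rule exI[of _ "{}"], rule exI[of _ "\<lambda>_. - 1"],
        rule exI[of _ "\<lambda>_. 1"], rule exI[of _ "\<lambda>_. 0"]) simp
next
  case (Suc n)
  then have "n \<le> d * m"
    by simp
  from Suc.IH[OF this] obtain orc X l u and k :: "nat \<Rightarrow> nat"
    where run: "\<forall>t<n. query alg (state_at alg orc t) \<in> X"
      and ans: "\<forall>x\<in>X. \<exists>g. orc x = Separator g \<and> separates d (open_box d l u) x g"
      and box: "\<forall>i<d. - 1 \<le> l i \<and> u i \<le> 1 \<and> u i - l i = 2 / 2 ^ k i \<and> k i \<le> m"
      and count: "(\<Sum>i<d. k i) \<le> n"
    by (elim exE conjE) (rule that)
  define x where "x = query alg (state_at alg orc n)"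
  show ?case
  proof (cases "x \<in> X")
    case True
    then have run': "\<forall>t<Suc n. query alg (state_at alg orc t) \<in> X"
      using run by (auto simp: less_Suc_eq x_def)
    show ?thesis
      by ((rule exI)+, intro conjI, rule run', rule ans, rule box, rule le_SucI[OF count])
  next
    case False
    have "\<exists>i<d. k i < m"
    proof (rule ccontr)
      assume "\<not> ?thesis"
      then have "(\<Sum>i<d. m) \<le> (\<Sum>i<d. k i)"
        by (intro sum_mono) auto
      then show False
        using count Suc.prems by simp
    qed
    then obtain i where i: "i < d" "k i < m"
      by blast
    define c where "c = (l i + u i) / 2"
    define s :: real where "s = (if x $ i < c then 1 else - 1)"
    \<comment> \<open>The half kept is the one that does not contain the query; a query on the cutting
      hyperplane goes with the upper half. Openness of the box makes the cut strict.\<close>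
    define l' where "l' = (if x $ i < c then l(i := c) else l)"
    define u' where "u' = (if x $ i < c then u else u(i := c))"
    define k' where "k' = k(i := Suc (k i))"
    define orc' where "orc' = orc(x := Separator (s \<cdot>\<^sub>v unit_vec d i))"
    have width: "u i - l i = 2 / 2 ^ k i" "0 < u i - l i"
      using box i(1) by auto
    then have mid: "l i < c" "c < u i" "u i - c = 2 / 2 ^ Suc (k i)" "c - l i = 2 / 2 ^ Suc (k i)"
      by (simp_all add: c_def field_simps)
    have state: "state_at alg orc' t = state_at alg orc t" if "t \<le> n" for t
      using run False that by (intro state_at_cong) (auto simp: orc'_def)
    have run': "\<forall>t<Suc n. query alg (state_at alg orc' t) \<in> insert x X"
      using run by (auto simp: less_Suc_eq state x_def)
    have smaller: "open_box d l' u' \<subseteq> open_box d l u"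
      using mid by (intro open_box_mono) (auto simp: l'_def u'_def)
    have new: "separates d (open_box d l' u') x (s \<cdot>\<^sub>v unit_vec d i)"
    proof (rule separates_by_coordinate)
      show "x \<in> carrier_vec d"
        using assms(1) by (simp add: x_def cube_def)
      fix x' assume "x' \<in> open_box d l' u'"
      then have "l' i < x' $ i" "x' $ i < u' i"
        using i(1) by (auto simp: open_box_def)
      then show "s * x $ i < s * x' $ i"
        by (auto simp: s_def l'_def u'_def split: if_splits)
    qed (use i in \<open>auto simp: s_def open_box_def\<close>)
    have ans': "\<forall>z\<in>insert x X. \<exists>g. orc' z = Separator g \<and> separates d (open_box d l' u') z g"
      using ans new separates_mono[OF _ smaller] by (auto simp: orc'_def)
    have box': "\<forall>j<d. - 1 \<le> l' j \<and> u' j \<le> 1 \<and> u' j - l' j = 2 / 2 ^ k' j \<and> k' j \<le> m"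
    proof (intro allI impI)
      fix j assume j: "j < d"
      show "- 1 \<le> l' j \<and> u' j \<le> 1 \<and> u' j - l' j = 2 / 2 ^ k' j \<and> k' j \<le> m"
      proof (cases "j = i")
        case True
        have "- 1 \<le> l i" "u i \<le> 1"
          using box i(1) by auto
        then show ?thesis
          using True i(2) mid by (auto simp: l'_def u'_def k'_def)
      next
        case False
        then show ?thesis
          using box j by (auto simp: l'_def u'_def k'_def)
      qed
    qed
    have "(\<Sum>j<d. k' j) = Suc (\<Sum>j<d. k j)"
      using i(1) by (simp add: k'_def sum.remove[of "{..<d}" i])
    then have count': "(\<Sum>j<d. k' j) \<le> Suc n"
      using count by simp
    show ?thesis
      by ((rule exI)+, intro conjI, rule run', rule ans', rule box', rule count')
  qed
qed

text \<open>
  The transcript of the adversary is extended to an oracle for a cube of radius \<open>\<epsilon>\<close> about the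
  centre of the remaining box; the cube lies inside the open box, so the recorded answers are valid
  separators for it and in particular none of the recorded queries belongs to it.
\<close>

lemma calls_lower_bound:
  fixes alg :: "'s algorithm"
  assumes "algorithm_on d UNIV alg" "solves_in d \<epsilon> N alg" "0 < \<epsilon>" "\<epsilon> < 1 / 2 ^ m"
  shows "d * m < N"
proof (rule ccontr)
  assume "\<not> d * m < N"
  then have "N \<le> d * m"
    by simp
  moreover have in_cube: "query alg s \<in> cube d" for s
    using assms(1) by (simp add: algorithm_on_def)
  ultimately obtain orc X l u and k :: "nat \<Rightarrow> nat"
    where run: "\<forall>t<N. query alg (state_at alg orc t) \<in> X"
      and ans: "\<forall>x\<in>X. \<exists>g. orc x = Separator g \<and> separates d (open_box d l u) x g"
      and box: "\<forall>i<d. - 1 \<le> l i \<and> u i \<le> 1 \<and> u i - l i = 2 / 2 ^ k i \<and> k i \<le> m"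
    using resisting_transcript[of alg d N m] by metis
  define c where "c = vec d (\<lambda>i. (l i + u i) / 2)"
  define Q where "Q = max_ball d c \<epsilon>"
  have c: "c \<in> carrier_vec d" "\<And>i. i < d \<Longrightarrow> c $ i = (l i + u i) / 2"
    by (simp_all add: c_def)
  have radius: "\<epsilon> < (u i - l i) / 2" if "i < d" for i
  proof -
    have "(1 :: real) / 2 ^ m \<le> 1 / 2 ^ k i"
      using box that by (intro divide_left_mono power_increasing) auto
    then show ?thesis
      using assms(4) box that by simp
  qed
  have Q_box: "Q \<subseteq> open_box d l u"
  proof
    fix x assume "x \<in> Q"
    then have x: "x \<in> carrier_vec d" "\<And>i. i < d \<Longrightarrow> \<bar>x $ i - c $ i\<bar> \<le> \<epsilon>"
      by (auto simp: Q_def max_ball_def)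
    have "l i < x $ i \<and> x $ i < u i" if "i < d" for i
      using x(2)[OF that] radius[OF that] c(2)[OF that] by (simp add: abs_le_iff field_simps)
    then show "x \<in> open_box d l u"
      using x(1) by (simp add: open_box_def)
  qed
  have box_cube: "open_box d l u \<subseteq> cube d"
    using box by (force simp: open_box_def cube_def)
  have "c \<in> Q"
    using c(1) assms(3) by (simp add: Q_def max_ball_def)
  then have "c \<in> cube d" "Q \<subseteq> cube d"
    using Q_box box_cube by auto
  moreover have "convex_vecs Q" "vec_ball d c \<epsilon> \<subseteq> Q"
    using convex_max_ball[OF c(1)] vec_ball_subset_max_ball[OF c(1)] by (simp_all add: Q_def)
  ultimately have inst: "feasibility_instance d \<epsilon> Q"
    unfolding feasibility_instance_def by blast
  have ansQ: "\<exists>g. orc x = Separator g \<and> separates d Q x g" if "x \<in> X" for x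
    using ans that separates_mono[OF _ Q_box] by blast
  define orc' where "orc' x =
    (if x \<in> X then orc x else if x \<in> Q then Success else Separator (SOME g. separates d Q x g))"
    for x
  have "separation_oracle d Q orc'"
    unfolding separation_oracle_def
  proof
    fix x assume "x \<in> cube d"
    then have x: "x \<in> carrier_vec d"
      by (simp add: cube_def)
    show "if x \<in> Q then orc' x = Success
      else \<exists>g\<in>carrier_vec d. orc' x = Separator g \<and> vec_norm2 g = 1 \<and> (\<forall>x'\<in>Q. g \<bullet> x < g \<bullet> x')"
    proof (cases "x \<in> Q")
      case True
      have "x \<notin> X"
        using ansQ True by (force simp: separates_def)
      then show ?thesis
        using True by (simp add: orc'_def)
    next
      case False
      have "\<exists>g. orc' x = Separator g \<and> separates d Q x g"
      proof (cases "x \<in> X")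
        case True
        then show ?thesis
          using ansQ by (simp add: orc'_def)
      next
        case new: False
        have "\<exists>g. separates d Q x g"
          using max_ball_separator[OF x] False by (simp add: Q_def)
        from someI_ex[OF this] show ?thesis
          using new False by (simp add: orc'_def)
      qed
      then show ?thesis
        using False by (auto simp: separates_def)
    qed
  qed
  then obtain t where t: "t < N" "orc' (query alg (state_at alg orc' t)) = Success"
    using assms(2) inst unfolding solves_in_def by blast
  have "state_at alg orc' t = state_at alg orc t"
    using run t(1) by (intro state_at_cong) (auto simp: orc'_def)
  moreover have "query alg (state_at alg orc t) \<in> X"
    using run t(1) by simp
  ultimately show False
    using t(2) ansQ by (force simp: orc'_def)
qed

lemma calls_lower_bound_ln:
  fixes alg :: "'s algorithm"
  assumes "algorithm_on d UNIV alg" "solves_in d \<epsilon> N alg" "0 < \<epsilon>" "2 \<le> ln (1 / \<epsilon>)"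
  shows "1 / 2 * (real d * ln (1 / \<epsilon>)) \<le> real N"
proof -
  define L where "L = ln (1 / \<epsilon>)"
  define m where "m = nat \<lfloor>L\<rfloor>"
  have m: "real m \<le> L" "L - 1 < real m" "0 < real m"
    using nat_floor_bounds[of L] assms(4) by (simp_all add: m_def L_def[symmetric])
  have "(2 :: real) < exp 1"
    using exp_ge_one_plus_x_over_n_power_n[of 2 1] by (simp add: power2_eq_square)
  then have "(2 :: real) ^ m < exp 1 ^ m"
    using m(3) by (intro power_strict_mono) auto
  also have "\<dots> \<le> exp L"
    using m(1) by (simp flip: exp_of_nat_mult)
  also have "\<dots> = 1 / \<epsilon>"
    using assms(3) by (simp add: L_def del: ln_div)
  finally have "\<epsilon> < 1 / 2 ^ m"
    using assms(3) by (simp add: field_simps)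
  then have "d * m < N"
    by (rule calls_lower_bound[OF assms(1-3)])
  then have "real d * real m \<le> real N"
    by (simp flip: of_nat_mult)
  moreover have "real d * (L / 2) \<le> real d * real m"
    using m(2) assms(4) unfolding L_def[symmetric] by (intro mult_left_mono) auto
  ultimately show ?thesis
    by (simp add: L_def del: ln_div)
qed

section \<open>The trade-off\<close>

lemma solves_with_mono:
  "solves_with d \<epsilon> alg M N \<Longrightarrow> M \<le> M' \<Longrightarrow> N \<le> N' \<Longrightarrow> solves_with d \<epsilon> alg M' N'"
  unfolding solves_with_def by (meson order_trans)

theorem corollary3p1:
  fixes C :: real and A :: "nat \<Rightarrow> nat \<Rightarrow> real \<Rightarrow> bool list algorithm"
  assumes "C \<ge> 1"
    and "feasibility_family C A"
  shows "\<exists>K>0. \<exists>c>0. \<exists>\<kappa>>0. \<forall>d\<ge>2. \<forall>\<epsilon>>0. ln (1 / \<epsilon>) \<ge> K * ln (real d) \<longrightarrow>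
    (\<exists>p_max. 1 \<le> p_max \<and> p_max \<le> d \<and>
       real p_max \<le> c * min (ln (1 / \<epsilon>) / ln (real d)) (real d) \<and>
       (\<forall>p\<in>{1..p_max}.
          solves_with d \<epsilon> (A d p \<epsilon>) (c * memory_rate d p \<epsilon>) (c * oracle_rate C d p \<epsilon>)) \<and>
       (\<forall>p q. 1 \<le> p \<and> p < q \<and> q \<le> p_max \<longrightarrow>
          memory_rate d q \<epsilon> < memory_rate d p \<epsilon> \<and>
          oracle_rate C d p \<epsilon> < oracle_rate C d q \<epsilon>) \<and>
       solves_with d \<epsilon> (A d 1 \<epsilon>)
         (c * (real d ^ 2 * ln (1 / \<epsilon>)))
         (c * (real d * ln (1 / \<epsilon>))) \<and>
       (\<forall>B N. unrestricted_algorithm d B \<and> solves_in d \<epsilon> N B \<longrightarrow>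
          \<kappa> * (real d * ln (1 / \<epsilon>)) \<le> real N) \<and>
       solves_with d \<epsilon> (A d p_max \<epsilon>)
         (c * max (real d ^ 2 * ln (real d)) (real d * ln (1 / \<epsilon>)))
         (c * min (1 / \<epsilon> ^ 2) ((C * ln (1 / \<epsilon>)) ^ d)))"
proof -
  from assms(2) obtain a b where "0 < a" "0 < b"
    and family: "\<And>d p \<epsilon>. 2 \<le> d \<Longrightarrow> p \<in> {1..d} \<Longrightarrow> 0 < \<epsilon> \<Longrightarrow> \<epsilon> \<le> 1 / sqrt (real d) \<Longrightarrow>
      solves_with d \<epsilon> (A d p \<epsilon>) (a * memory_rate d p \<epsilon>) (b * oracle_rate C d p \<epsilon>)"
    unfolding feasibility_family_def by blast
  \<comment> \<open>\<open>6 * C\<close> makes \<open>L / (4 * C * ln d)\<close> at least 1 and, since \<open>ln 2 \<ge> 1 / 2\<close>, also \<open>L \<ge> 3\<close>.\<close>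
  define K where "K = 6 * C"
  \<comment> \<open>The summand \<open>8 * C * a\<close> pays for the factor lost in the memory at \<open>p_max\<close>, and \<open>8 * C * b\<close>
    for the factor \<open>C\<close> in the call bound at \<open>p = 1\<close>; the summand 1 is for \<open>p_max\<close> itself.\<close>
  define c where "c = 1 + 8 * C * (a + b)"
  have aC: "a \<le> C * a" and bC: "b \<le> C * b"
    using assms(1) \<open>0 < a\<close> \<open>0 < b\<close> by simp_all
  have c_eq: "c = 1 + 8 * (C * a) + 8 * (C * b)"
    by (simp add: c_def algebra_simps)
  have c: "1 \<le> c" "a \<le> c" "b \<le> c" "a * (8 * C) \<le> c" "b * C \<le> c"
    unfolding c_eq mult.left_commute[of a] mult.commute[of b] mult.commute[of a]
    using aC bC \<open>0 < a\<close> \<open>0 < b\<close> by linarith+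
  have "0 < K" "0 < c" "(0 :: real) < 1 / 2"
    using assms(1) c(1) by (simp_all add: K_def)
  show ?thesis
  proof (rule exI[of _ K], rule conjI[OF \<open>0 < K\<close>], rule exI[of _ c], rule conjI[OF \<open>0 < c\<close>],
      rule exI[of _ "1 / 2"], rule conjI[OF \<open>0 < 1 / 2\<close>], intro allI impI)
    fix d :: nat and \<epsilon> :: real
    assume d: "2 \<le> d" and eps: "0 < \<epsilon>" and large: "K * ln (real d) \<le> ln (1 / \<epsilon>)"
    define L where "L = ln (1 / \<epsilon>)"
    define D where "D = ln (real d)"
    define x where "x = L / (4 * C * D)"
    define p_max where "p_max = min d (nat \<lfloor>x\<rfloor>)"
    have D: "1 / 2 \<le> D"
      using ln_ge_half[OF d] by (simp add: D_def)
    have CD: "D \<le> C * D"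
      using assms(1) D by simp
    have LD: "6 * (C * D) \<le> L"
      using large by (simp add: K_def L_def D_def del: ln_div)
    have L: "3 \<le> L" "D \<le> L"
      using LD CD D by linarith+
    have "0 < 4 * C * D" "4 * C * D \<le> L"
      using LD CD D by linarith+
    then have "1 \<le> x"
      by (simp add: x_def)
    have "x \<le> L / D"
      unfolding x_def using CD D L assms(1) by (intro divide_left_mono) auto
    have eps_small: "\<epsilon> \<le> 1 / sqrt (real d)"
    proof -
      have "ln (sqrt (real d)) \<le> ln (1 / \<epsilon>)"
        using L(2) D d by (simp add: ln_sqrt D_def L_def)
      then have "sqrt (real d) \<le> 1 / \<epsilon>"
        using d eps by (subst (asm) ln_le_cancel_iff) auto
      then show ?thesis
        using d eps by (simp add: field_simps)
    qed
    have p: "1 \<le> p_max" "p_max \<le> d" "real p_max \<le> x"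
      using d nat_floor_bounds[OF \<open>1 \<le> x\<close>] unfolding p_max_def by linarith+
    have memory_nonneg: "0 \<le> memory_rate d p \<epsilon>" for p
      using L(1) by (simp add: memory_rate_def L_def[symmetric])
    have oracle_nonneg: "0 \<le> oracle_rate C d p \<epsilon>" for p
      using L(1) assms(1) by (simp add: oracle_rate_def L_def[symmetric])
    have solves: "solves_with d \<epsilon> (A d p \<epsilon>) M N"
      if "p \<in> {1..d}" "a * memory_rate d p \<epsilon> \<le> M" "b * oracle_rate C d p \<epsilon> \<le> N" for p M N
      using solves_with_mono[OF family[OF d that(1) eps eps_small]] that(2,3) .
    show "\<exists>p_max. 1 \<le> p_max \<and> p_max \<le> d \<and>
       real p_max \<le> c * min (ln (1 / \<epsilon>) / ln (real d)) (real d) \<and>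
       (\<forall>p\<in>{1..p_max}.
          solves_with d \<epsilon> (A d p \<epsilon>) (c * memory_rate d p \<epsilon>) (c * oracle_rate C d p \<epsilon>)) \<and>
       (\<forall>p q. 1 \<le> p \<and> p < q \<and> q \<le> p_max \<longrightarrow>
          memory_rate d q \<epsilon> < memory_rate d p \<epsilon> \<and>
          oracle_rate C d p \<epsilon> < oracle_rate C d q \<epsilon>) \<and>
       solves_with d \<epsilon> (A d 1 \<epsilon>)
         (c * (real d ^ 2 * ln (1 / \<epsilon>)))
         (c * (real d * ln (1 / \<epsilon>))) \<and>
       (\<forall>B N. unrestricted_algorithm d B \<and> solves_in d \<epsilon> N B \<longrightarrow>
          1 / 2 * (real d * ln (1 / \<epsilon>)) \<le> real N) \<and>
       solves_with d \<epsilon> (A d p_max \<epsilon>)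
         (c * max (real d ^ 2 * ln (real d)) (real d * ln (1 / \<epsilon>)))
         (c * min (1 / \<epsilon> ^ 2) ((C * ln (1 / \<epsilon>)) ^ d))"
    proof (intro exI[of _ p_max] conjI ballI allI impI)
      have "real p_max \<le> 1 * min (L / D) (real d)"
        using p \<open>x \<le> L / D\<close> by simp
      also have "\<dots> \<le> c * min (L / D) (real d)"
        using c(1) D L by (intro mult_right_mono) auto
      finally show "real p_max \<le> c * min (ln (1 / \<epsilon>) / ln (real d)) (real d)"
        by (simp add: L_def D_def del: ln_div)
    next
      fix p assume "p \<in> {1..p_max}"
      then show "solves_with d \<epsilon> (A d p \<epsilon>) (c * memory_rate d p \<epsilon>) (c * oracle_rate C d p \<epsilon>)"
        using p(2) c memory_nonneg oracle_nonneg by (intro solves mult_right_mono) auto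
    next
      fix p q assume "1 \<le> p \<and> p < q \<and> q \<le> p_max"
      then show "memory_rate d q \<epsilon> < memory_rate d p \<epsilon>"
          "oracle_rate C d p \<epsilon> < oracle_rate C d q \<epsilon>"
        using assms(1) d p(2) L(1) unfolding L_def
        by (auto intro!: memory_rate_less oracle_rate_less simp del: ln_div)
    next
      have "a * memory_rate d 1 \<epsilon> \<le> c * (real d ^ 2 * L)"
        using c(2) L(1) by (simp add: memory_rate_def L_def[symmetric] mult_right_mono)
      moreover have "b * oracle_rate C d 1 \<epsilon> \<le> c * (real d * L)"
        using mult_right_mono[OF c(5), of "real d * L"] L(1)
        by (simp add: oracle_rate_def L_def[symmetric] mult.assoc)
      ultimately show "solves_with d \<epsilon> (A d 1 \<epsilon>)
          (c * (real d ^ 2 * ln (1 / \<epsilon>))) (c * (real d * ln (1 / \<epsilon>)))"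
        using d unfolding L_def by (intro solves) auto
    next
      fix B N assume "unrestricted_algorithm d B \<and> solves_in d \<epsilon> N B"
      then show "1 / 2 * (real d * ln (1 / \<epsilon>)) \<le> real N"
        using L(1) eps unfolding unrestricted_algorithm_def L_def
        by (intro calls_lower_bound_ln) auto
    next
      let ?M = "max (real d ^ 2 * ln (real d)) (real d * ln (1 / \<epsilon>))"
      let ?N = "min (1 / \<epsilon> ^ 2) ((C * ln (1 / \<epsilon>)) ^ d)"
      have "a * memory_rate d p_max \<epsilon> \<le> a * (8 * C * ?M)"
        using memory_rate_at_max[OF assms(1) d, of \<epsilon>] \<open>1 \<le> x\<close> \<open>0 < a\<close>
        unfolding p_max_def x_def L_def D_def by (intro mult_left_mono) auto
      also have "\<dots> = a * (8 * C) * ?M"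
        by simp
      also have "\<dots> \<le> c * ?M"
        using c(4) L(1) unfolding L_def by (intro mult_right_mono) (auto simp: le_max_iff_disj)
      finally have memory: "a * memory_rate d p_max \<epsilon> \<le> c * ?M" .
      have "oracle_rate C d p_max \<epsilon> \<le> 1 / \<epsilon> ^ 2"
        using assms(1) d p eps L(1) unfolding x_def L_def D_def
        by (intro oracle_rate_le_inverse_square) linarith+
      moreover have "oracle_rate C d p_max \<epsilon> \<le> (C * ln (1 / \<epsilon>)) ^ d"
        using assms(1) p L(1) unfolding L_def by (intro oracle_rate_le_full)
      ultimately have "b * oracle_rate C d p_max \<epsilon> \<le> c * ?N"
        using c(3) \<open>0 < b\<close> oracle_nonneg by (intro mult_mono) auto
      with memory show "solves_with d \<epsilon> (A d p_max \<epsilon>) (c * ?M) (c * ?N)"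
        using p by (intro solves) auto
    qed (use p in auto)
  qed
qed

end
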